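(* Let $X$ be a Banach space and let $f,g:X\to X$ be Matkowski contractions. Assume that $f$ is compact (i.e., the closure of $f(D)$ is compact for every bounded $D\subset X$; $f$ need not be linear), and that $g$ satisfies at least one of the following conditions: (i) $g$ is affine and $\operatorname{Lip}(g)<1$; (ii) $\operatorname{Lip}(g)\le \frac12$. Then the set $C_{f,g}$ is a countable union of compact sets. In particular, if $X$ is infinite dimensional, then $C_{f,g}$ is $\sigma$-c-porous.
   Context: A map $h:X\to X$ on a metric space $(X,d)$ is a Matkowski contraction if there is a nondecreasing function $\varphi:[0,\infty)\to\mathbb R$ with $\varphi^{(n)}(t)\to 0$ as $n\to\infty$ for every $t\ge 0$ ($\varphi^{(n)}$ is the $n$-th iterate) such that $d(h(x),h(y))\le\varphi(d(x,y))$ for all $x,y\in X$. (The inequality with $x=y$ and monotonicity force $\varphi\ge 0$, so the iterates make sense.) $\operatorname{Lip}(g)$ denotes the Lipschitz constant of $g$. A map $g$ is affine if $g=\tilde g+a$ for a linear map $\tilde g$ and some $a\in X$. For a complete metric space $X$ and a finite family $\mathcal F$ of Matkowski contractions of $X$ (an iterated function system, IFS), the attractor $A_{\mathcal F}$ is the unique nonempty compact set $A\subset X$ with $A=\bigcup_{h\in\mathcal F}h(A)$ (it exists and is unique). For a Banach space $X$, Matkowski contractions $f,g:X\to X$ and $w\in X$, put $g_w(x):=g(x)+w$ and $\mathcal F_w:=\{f,g_w\}$. Define $C_{f,g}:=\{w\in X: A_{\mathcal F_w}\text{ is connected}\}$. A subset $M$ of a Banach space is c-porous if its convex hull is nowhere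 dense; $M$ is $\sigma$-c-porous if it is a countable union of c-porous sets. *)

theory Defs
  imports "HOL-Analysis.Analysis"
begin

(* The comparison function is a total function on the reals, but only its values on the
   half-line t >= 0 matter: the inequality at x = y and monotonicity give \<phi> t >= 0 for all
   t >= 0, so the iterates started at t >= 0 never leave the half-line. *)
definition Matkowski_contraction :: "('a::metric_space \<Rightarrow> 'a) \<Rightarrow> bool" where
  "Matkowski_contraction h \<longleftrightarrow>
     (\<exists>\<phi> :: real \<Rightarrow> real.
        mono_on {0..} \<phi> \<and>
        (\<forall>t\<ge>0. (\<lambda>n. (\<phi> ^^ n) t) \<longlonglongrightarrow> 0) \<and>
        (\<forall>x y. dist (h x) (h y) \<le> \<phi> (dist x y)))"

(* Extended-real valued, so that a map that is not Lipschitz has constant \<infinity>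
   (the infimum of the empty set). *)
definition Lip :: "('a::metric_space \<Rightarrow> 'b::metric_space) \<Rightarrow> ereal" where
  "Lip h = (INF L\<in>{L. L-lipschitz_on UNIV h}. ereal L)"

definition affine_map :: "('a::real_vector \<Rightarrow> 'b::real_vector) \<Rightarrow> bool" where
  "affine_map h \<longleftrightarrow> (\<exists>h' a. linear h' \<and> h = (\<lambda>x. h' x + a))"

(* Not assumed to be linear. *)
definition compact_map :: "('a::metric_space \<Rightarrow> 'b::metric_space) \<Rightarrow> bool" where
  "compact_map h \<longleftrightarrow> (\<forall>D. bounded D \<longrightarrow> compact (closure (h ` D)))"

(* Meaningful for finite families of Matkowski contractions of a complete metric space,
   where existence and uniqueness are guaranteed. *)
definition attractor :: "('a::metric_space \<Rightarrow> 'a) set \<Rightarrow> 'a set" where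
  "attractor F = (THE A. A \<noteq> {} \<and> compact A \<and> A = (\<Union>h\<in>F. h ` A))"

definition connectedness_set :: "('a::banach \<Rightarrow> 'a) \<Rightarrow> ('a \<Rightarrow> 'a) \<Rightarrow> 'a set" where
  "connectedness_set f g = {w. connected (attractor {f, \<lambda>x. g x + w})}"

definition nowhere_dense :: "'a::topological_space set \<Rightarrow> bool" where
  "nowhere_dense M \<longleftrightarrow> interior (closure M) = {}"

definition c_porous :: "'a::real_normed_vector set \<Rightarrow> bool" where
  "c_porous M \<longleftrightarrow> nowhere_dense (convex hull M)"

definition sigma_c_porous :: "'a::real_normed_vector set \<Rightarrow> bool" where
  "sigma_c_porous M \<longleftrightarrow> (countable union_of c_porous) M"

definition infinite_dimensional :: "'a::real_vector itself \<Rightarrow> bool" where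
  "infinite_dimensional _ \<longleftrightarrow> (\<nexists>B :: 'a set. finite B \<and> span B = UNIV)"

end

theory Submission
  imports Defs
begin

text \<open>
  Write \<open>g\<^sub>w\<close> for \<open>\<lambda>x. g x + w\<close> and \<open>A\<^sub>w\<close> for the attractor of \<open>f\<close> and \<open>g\<^sub>w\<close>. It depends continuously on
  \<open>w\<close> in the Hausdorff sense, so \<open>C\<close> is closed. If \<open>A\<^sub>w\<close> is connected, then \<open>f a \<in> g\<^sub>w ` A\<^sub>w\<close> for
  some \<open>a \<in> A\<^sub>w\<close>. Reading off the code of \<open>y = f a\<close>, either \<open>y = g\<^sub>w\<^sup>k x\<close> with \<open>k \<ge> 1\<close> and
  \<open>x \<in> f ` A\<^sub>w\<close>, or \<open>y\<close> is the fixed point of \<open>g\<^sub>w\<close> and \<open>w = y - g y\<close>. For bounded \<open>w\<close> the points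
  \<open>x\<close> and \<open>y\<close> lie in a fixed compact set, because \<open>f\<close> is compact. Either condition on \<open>g\<close> bounds
  the distance of \<open>g\<^sub>v\<^sup>k x\<close> and \<open>g\<^sub>w\<^sup>k x\<close> from below by a multiple of that of \<open>v\<close> and \<open>w\<close>, so for each \<open>k\<close>
  the parameters \<open>w\<close> of the first kind form a compact set as well.
\<close>

section \<open>Compact sets in infinite dimension\<close>

lemma infdist_lessE:
  assumes "Y \<noteq> {}" "infdist x Y < e"
  obtains y where "y \<in> Y" "dist x y < e"
proof -
  have "bdd_below (dist x ` Y)" by (rule bdd_belowI[of _ 0]) auto
  then show ?thesis using assms that by (auto simp: infdist_notempty cINF_less_iff)
qed

text \<open>The distance \<open>d\<close> of \<open>b\<close> from \<open>Y\<close> is positive and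
  \<open>norm (y + t *\<^sub>R b)\<close> is at least \<open>d\<close> times the absolute value of
  \<open>t\<close>. So the coefficients along a convergent sequence are Cauchy, and the
  \<open>Y\<close>-parts converge too.\<close>

lemma closed_subspace_insert:
  fixes b :: "'a::real_normed_vector"
  assumes Y: "subspace Y" "closed Y"
  shows "closed {y + t *\<^sub>R b | y t. y \<in> Y}"
proof (cases "b \<in> Y")
  case True
  then have "{y + t *\<^sub>R b | y t. y \<in> Y} = Y"
    using Y(1) by (auto intro!: subspace_add subspace_scale exI[of _ "0::real"])
  then show ?thesis using Y by simp
next
  case False
  define d where "d = infdist b Y"
  have d: "d > 0"
    unfolding d_def using False Y subspace_0 by (intro infdist_pos_not_in_closed) auto
  have bound: "\<bar>t\<bar> * d \<le> norm (y + t *\<^sub>R b)" if "y \<in> Y" for y t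
  proof (cases "t = 0")
    case nz: False
    have "(- 1 / t) *\<^sub>R y \<in> Y" using that Y(1) by (intro subspace_scale)
    then have "d \<le> dist b ((- 1 / t) *\<^sub>R y)" unfolding d_def by (rule infdist_le)
    then have "\<bar>t\<bar> * d \<le> \<bar>t\<bar> * norm (b - (- 1 / t) *\<^sub>R y)"
      by (intro mult_left_mono) (auto simp: dist_norm)
    also have "\<dots> = norm (t *\<^sub>R (b - (- 1 / t) *\<^sub>R y))" by simp
    also have "t *\<^sub>R (b - (- 1 / t) *\<^sub>R y) = y + t *\<^sub>R b"
      using nz by (simp add: algebra_simps)
    finally show ?thesis .
  qed simp
  show ?thesis
    unfolding closed_sequential_limits
  proof (intro allI impI, elim conjE)
    fix x l
    assume "\<forall>n. x n \<in> {y + t *\<^sub>R b |y t. y \<in> Y}" and lim: "x \<longlonglongrightarrow> l"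
    then have "\<forall>n. \<exists>y t. x n = y + t *\<^sub>R b \<and> y \<in> Y" by blast
    then obtain y t where xyt: "\<And>n. x n = y n + t n *\<^sub>R b" and yY: "\<And>n. y n \<in> Y" by metis
    have "Cauchy t"
    proof (rule metric_CauchyI)
      fix e :: real assume "e > 0"
      then have "e * d > 0" using d by simp
      then obtain M where M: "\<And>m n. m \<ge> M \<Longrightarrow> n \<ge> M \<Longrightarrow> dist (x m) (x n) < e * d"
        using LIMSEQ_imp_Cauchy[OF lim] unfolding Cauchy_def by metis
      have "dist (t m) (t n) < e" if "m \<ge> M" "n \<ge> M" for m n
      proof -
        have "\<bar>t m - t n\<bar> * d \<le> norm ((y m - y n) + (t m - t n) *\<^sub>R b)"
          using yY Y(1) by (intro bound subspace_diff)
        also have "\<dots> = dist (x m) (x n)" by (simp add: xyt dist_norm algebra_simps)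
        also have "\<dots> < e * d" using M that by blast
        finally show ?thesis using d by (simp add: dist_norm)
      qed
      then show "\<exists>M. \<forall>m\<ge>M. \<forall>n\<ge>M. dist (t m) (t n) < e" by blast
    qed
    then obtain s where s: "t \<longlonglongrightarrow> s" using Cauchy_convergent convergent_def by blast
    have "(\<lambda>n. x n - t n *\<^sub>R b) \<longlonglongrightarrow> l - s *\<^sub>R b" using lim s by (intro tendsto_intros)
    moreover have "(\<lambda>n. x n - t n *\<^sub>R b) = y" by (simp add: xyt)
    ultimately have "l - s *\<^sub>R b \<in> Y" using Y(2) yY closed_sequentially by metis
    then show "l \<in> {y + t *\<^sub>R b |y t. y \<in> Y}"
      by (auto intro!: exI[of _ "l - s *\<^sub>R b"] exI[of _ s])
  qed
qed

lemma closed_span_finite: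
  fixes B :: "'a::real_normed_vector set"
  assumes "finite B"
  shows "closed (span B)"
  using assms
proof (induction B)
  case (insert b B)
  have "span (insert b B) = {y + t *\<^sub>R b | y t. y \<in> span B}"
  proof (intro set_eqI iffI)
    fix x assume "x \<in> span (insert b B)"
    then obtain t where "x - t *\<^sub>R b \<in> span B" unfolding span_insert by blast
    then show "x \<in> {y + t *\<^sub>R b | y t. y \<in> span B}"
      by (auto intro!: exI[of _ "x - t *\<^sub>R b"] exI[of _ t])
  next
    fix x assume "x \<in> {y + t *\<^sub>R b | y t. y \<in> span B}"
    then obtain y t where "x = y + t *\<^sub>R b" "y \<in> span B" by blast
    then show "x \<in> span (insert b B)"
      unfolding span_insert by (auto intro!: exI[of _ t])
  qed
  then show ?case using closed_subspace_insert[OF _ insert.IH] by simp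
qed simp

text \<open>If the hull were somewhere dense, there would be a finite-dimensional, hence closed,
  subspace to which every vector \<open>v\<close> has distance less than \<open>norm v / 2\<close>, so it would be
  everything.\<close>

lemma compact_imp_c_porous:
  fixes K :: "'a::real_normed_vector set"
  assumes K: "compact K" and inf: "infinite_dimensional TYPE('a)"
  shows "c_porous K"
  unfolding c_porous_def nowhere_dense_def
proof (rule ccontr)
  assume "interior (closure (convex hull K)) \<noteq> {}"
  then obtain x r where r: "r > 0" and sub: "ball x r \<subseteq> closure (convex hull K)"
    by (metis ex_in_conv mem_interior)
  \<comment> \<open>Points of the closed hull will lie within \<open>2 * e\<close> of
    \<open>Y\<close>; a difference of two of them doubles this to
    \<open>4 * e = r / 4\<close>.\<close>
  define e where "e = r / 16"
  have e: "e > 0" using r by (simp add: e_def)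
  obtain F where F: "finite F" "K \<subseteq> (\<Union>c\<in>F. ball c e)"
    using compact_imp_seq_compact[OF K] seq_compact_imp_totally_bounded e by metis
  define Y where "Y = span F"
  have Y: "subspace Y" "closed Y" "Y \<noteq> UNIV"
    using F inf closed_span_finite unfolding Y_def infinite_dimensional_def by auto
  \<comment> \<open>The \<open>e\<close>-neighbourhood of \<open>Y\<close> is convex, so it contains
    the hull as soon as it contains \<open>K\<close>.\<close>
  define W where "W = (\<Union>y\<in>Y. \<Union>z\<in>ball 0 e. {y + z})"
  have "K \<subseteq> W"
  proof
    fix k assume "k \<in> K"
    then obtain c where "c \<in> F" "k \<in> ball c e" using F by auto
    then have "k = c + (k - c)" "c \<in> Y" "k - c \<in> ball 0 e"
      by (auto simp: Y_def span_base dist_norm norm_minus_commute)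
    then show "k \<in> W" unfolding W_def by blast
  qed
  moreover have "convex W"
    unfolding W_def by (rule convex_sums[OF subspace_imp_convex[OF Y(1)] convex_ball])
  ultimately have hull: "convex hull K \<subseteq> W" by (rule hull_minimal)
  have near: "\<exists>y\<in>Y. norm (z - y) < 2 * e" if z: "z \<in> closure (convex hull K)" for z
  proof -
    obtain w where w: "w \<in> W" "dist w z < e" using z hull e closure_approachable by blast
    then obtain y u where "w = y + u" "y \<in> Y" "norm u < e" unfolding W_def by auto
    moreover have "norm (z - y) \<le> norm (z - w) + norm (w - y)" by (rule norm_diff_triangle_le) auto
    ultimately show ?thesis using w by (intro bexI[of _ y]) (auto simp: dist_norm norm_minus_commute)
  qed
  have small: "\<exists>y\<in>Y. norm (u - y) < r / 4" if u: "norm u < r" for u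
  proof -
    have "x + u \<in> closure (convex hull K)" "x \<in> closure (convex hull K)"
      using sub u r by (auto simp: dist_norm)
    then obtain y1 y2 where y: "y1 \<in> Y" "y2 \<in> Y" "norm (x + u - y1) < 2 * e" "norm (x - y2) < 2 * e"
      using near by meson
    have "norm (u - (y1 - y2)) = norm ((x + u - y1) - (x - y2))" by (simp add: algebra_simps)
    also have "\<dots> < r / 4" using norm_triangle_ineq4[of "x + u - y1" "x - y2"] y by (simp add: e_def)
    finally show ?thesis using y Y(1) subspace_diff by blast
  qed
  have half: "\<exists>y\<in>Y. norm (v - y) < norm v / 2" if "v \<noteq> 0" for v
  proof -
    \<comment> \<open>This scales \<open>v\<close> to norm \<open>r / 2\<close>, of which the error
      \<open>r / 4\<close> is one half.\<close>
    define c where "c = r / (2 * norm v)"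
    have c: "c > 0" using r that by (simp add: c_def)
    have "norm (c *\<^sub>R v) < r" using r that by (simp add: c_def)
    then obtain y where y: "y \<in> Y" "norm (c *\<^sub>R v - y) < r / 4" using small by blast
    have "c *\<^sub>R v - y = c *\<^sub>R (v - (1 / c) *\<^sub>R y)" using c by (simp add: algebra_simps)
    then have "c * norm (v - (1 / c) *\<^sub>R y) < c * (norm v / 2)"
      using y c that r by (simp add: c_def)
    then show ?thesis using c y Y(1) subspace_scale by (metis mult_less_cancel_left_pos)
  qed
  obtain v where v: "v \<notin> Y" using Y by auto
  have ne: "Y \<noteq> {}" using Y(1) subspace_0 by auto
  have "infdist v Y > 0" using Y v ne by (intro infdist_pos_not_in_closed)
  \<comment> \<open>Some \<open>y\<close> in \<open>Y\<close> is optimal up to a factor 2;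
    approximating the residual \<open>v - y\<close> by \<open>half\<close> then beats the
    infimum.\<close>
  then have "infdist v Y < 2 * infdist v Y" by simp
  then obtain y where y: "y \<in> Y" "dist v y < 2 * infdist v Y" by (rule infdist_lessE[OF ne])
  have "v - y \<noteq> 0" using v y by auto
  then obtain y' where y': "y' \<in> Y" "norm (v - y - y') < norm (v - y) / 2"
    using half by blast
  have "infdist v Y \<le> dist v (y + y')" using y y' Y(1) by (intro infdist_le subspace_add)
  also have "\<dots> = norm (v - y - y')" by (simp add: dist_norm algebra_simps)
  also have "\<dots> < infdist v Y" using y y' by (simp add: dist_norm)
  finally show False by simp
qed

section \<open>Matkowski contractions of normed spaces\<close>

text \<open>A contraction up to an additive error. The error is scaled so that \<open>s\<close> is
  the fixed point of \<open>t \<mapsto> L * t + (1 - L) * s\<close>; hence iteration never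
  accumulates more than \<open>s\<close>.\<close>

definition almost_contraction :: "real \<Rightarrow> real \<Rightarrow> ('a::metric_space \<Rightarrow> 'a) \<Rightarrow> bool" where
  "almost_contraction s L h \<longleftrightarrow> (\<forall>x y. dist (h x) (h y) \<le> L * dist x y + (1 - L) * s)"

lemma almost_contractionD:
  "almost_contraction s L h \<Longrightarrow> dist (h x) (h y) \<le> L * dist x y + (1 - L) * s"
  by (simp add: almost_contraction_def)

lemma almost_contraction_translate:
  fixes h :: "'a::real_normed_vector \<Rightarrow> 'a"
  shows "almost_contraction s L (\<lambda>x. h x + w) \<longleftrightarrow> almost_contraction s L h"
  by (simp add: almost_contraction_def)

text \<open>If \<open>t \<le> \<phi> t\<close> for some \<open>t > 0\<close>, monotonicity would
  keep all iterates at or above \<open>t\<close>, so they could not tend to 0.\<close>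

lemma Matkowski_contraction_step:
  assumes "Matkowski_contraction h"
  obtains \<phi> where "\<And>t. t > 0 \<Longrightarrow> \<phi> t < t" "\<And>x y. dist (h x) (h y) \<le> \<phi> (dist x y)"
proof -
  obtain \<phi> where mono: "mono_on {0..} \<phi>" and lim: "\<And>t. t \<ge> 0 \<Longrightarrow> (\<lambda>n. (\<phi> ^^ n) t) \<longlonglongrightarrow> 0"
    and dist: "\<And>x y. dist (h x) (h y) \<le> \<phi> (dist x y)"
    using assms unfolding Matkowski_contraction_def by auto
  have "\<phi> t < t" if t: "t > 0" for t
  proof (rule ccontr)
    assume "\<not> \<phi> t < t"
    then have ge: "t \<le> \<phi> t" by simp
    have "t \<le> (\<phi> ^^ n) t" for n
    proof (induction n)
      case (Suc n)
      then have "\<phi> t \<le> \<phi> ((\<phi> ^^ n) t)" using t by (intro mono_onD[OF mono]) auto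
      then show ?case using ge by simp
    qed simp
    then have "t \<le> 0" using t by (intro LIMSEQ_le_const[OF lim[of t]]) auto
    then show False using t by simp
  qed
  then show ?thesis using dist that by blast
qed

lemma Matkowski_contraction_nonexpansive:
  assumes "Matkowski_contraction h"
  shows "dist (h x) (h y) \<le> dist x y"
proof (cases "x = y")
  case False
  obtain \<phi> where "\<And>t. t > 0 \<Longrightarrow> \<phi> t < t" "\<And>x y. dist (h x) (h y) \<le> \<phi> (dist x y)"
    using Matkowski_contraction_step[OF assms] by metis
  then have "dist (h x) (h y) \<le> \<phi> (dist x y)" "\<phi> (dist x y) < dist x y" using False by auto
  then show ?thesis by simp
qed simp

text \<open>A segment of length at least \<open>s\<close> is cut into pieces of length \<open>s\<close>, each of which loses the
  fixed amount \<open>s - \<phi> s\<close>; the pieces cover at least half of the segment.\<close>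

lemma Matkowski_contraction_far:
  fixes h :: "'a::real_normed_vector \<Rightarrow> 'a"
  assumes h: "Matkowski_contraction h" and s: "s > 0"
  obtains L where "0 \<le> L" "L < 1" "\<And>x y. s \<le> dist x y \<Longrightarrow> dist (h x) (h y) \<le> L * dist x y"
proof -
  obtain \<phi> where \<phi>: "\<And>t. t > 0 \<Longrightarrow> \<phi> t < t" "\<And>x y. dist (h x) (h y) \<le> \<phi> (dist x y)"
    using Matkowski_contraction_step[OF h] by metis
  \<comment> \<open>Cutting off at 0 guarantees \<open>L \<ge> 0\<close> below. The 2 in
    \<open>L\<close> comes from rounding: at least \<open>t / (2 * s)\<close> whole pieces fit into
    a segment of length \<open>t \<ge> s\<close>.\<close>
  define c where "c = max 0 (\<phi> s)"
  have c: "0 \<le> c" "c < s" using \<phi>(1)[OF s] s by (auto simp: c_def)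
  define L where "L = 1 - (s - c) / (2 * s)"
  have "dist (h x) (h y) \<le> L * dist x y" if far: "s \<le> dist x y" for x y
  proof -
    define t where "t = dist x y"
    have t: "t > 0" "s \<le> t" using far s by (auto simp: t_def)
    \<comment> \<open>\<open>p i\<close> lies on the ray from \<open>x\<close> through
      \<open>y\<close> at distance \<open>i * s\<close> from \<open>x\<close>. The rest of the
      segment, from \<open>p m\<close> to \<open>y\<close>, is handled by nonexpansiveness
      alone.\<close>
    define p where "p i = x + (of_nat i * (s / t)) *\<^sub>R (y - x)" for i :: nat
    define m where "m = nat \<lfloor>t / s\<rfloor>"
    have ts: "t / s \<ge> 1" using t s by simp
    have m: "real m \<le> t / s" "t / s < real m + 1" "1 \<le> real m"
    proof -
      have "\<lfloor>t / s\<rfloor> \<ge> 1" using ts by (simp only: le_floor_iff of_int_1)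
      then have "real m = of_int \<lfloor>t / s\<rfloor>" "m \<ge> 1" unfolding m_def by linarith+
      then show "real m \<le> t / s" "t / s < real m + 1" "1 \<le> real m"
        using floor_correct[of "t / s"] by linarith+
    qed
    have chain: "dist (h x) (h (p i)) \<le> real i * c" for i
    proof (induction i)
      case (Suc i)
      have "p (Suc i) - p i = (s / t) *\<^sub>R (y - x)" by (simp add: p_def algebra_simps add_divide_distrib)
      then have "dist (p (Suc i)) (p i) = (s / t) * dist y x" using t s by (simp add: dist_norm)
      also have "\<dots> = s" using t by (simp add: t_def dist_commute)
      finally have "dist (p i) (p (Suc i)) = s" by (simp add: dist_commute)
      then have "dist (h (p i)) (h (p (Suc i))) \<le> c" using \<phi>(2)[of "p i" "p (Suc i)"] by (simp add: c_def)
      then show ?case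
        using Suc dist_triangle[of "h x" "h (p (Suc i))" "h (p i)"] by (simp add: algebra_simps)
    qed (simp add: p_def)
    have "p m - y = (real m * (s / t) - 1) *\<^sub>R (y - x)" by (simp add: p_def algebra_simps)
    then have "dist (p m) y = \<bar>real m * (s / t) - 1\<bar> * dist y x"
      by (simp only: dist_norm norm_scaleR)
    also have "dist y x = t" by (simp add: t_def dist_commute)
    also have "\<bar>real m * (s / t) - 1\<bar> * t = t - real m * s"
    proof -
      have "real m * s \<le> t" using m(1) s by (simp add: field_simps)
      then show ?thesis using t by (simp add: field_simps abs_if)
    qed
    finally have "dist (h (p m)) (h y) \<le> t - real m * s"
      using Matkowski_contraction_nonexpansive[OF h, of "p m" y] by simp
    then have "dist (h x) (h y) \<le> t - real m * (s - c)"
      using chain[of m] dist_triangle[of "h x" "h y" "h (p m)"] by (simp add: algebra_simps)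
    also have "\<dots> \<le> t - (t / (2 * s)) * (s - c)"
    proof -
      have "t / s \<le> 2 * real m" using m by linarith
      then have "t / (2 * s) \<le> real m" using s by (simp add: pos_divide_le_eq algebra_simps)
      then have "(t / (2 * s)) * (s - c) \<le> real m * (s - c)" using c by (intro mult_right_mono) auto
      then show ?thesis by simp
    qed
    also have "\<dots> = L * t" by (simp add: L_def algebra_simps)
    finally show ?thesis by (simp add: t_def)
  qed
  moreover have "0 \<le> L" "L < 1" using c s by (auto simp: L_def field_simps)
  ultimately show ?thesis using that by blast
qed

text \<open>Distant pairs are contracted by a factor; for pairs closer than \<open>s\<close> the
  additive error covers the gap to nonexpansiveness. Allowing every larger \<open>L\<close> lets two
  maps share one factor.\<close>

lemma Matkowski_contraction_imp_almost_contraction: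
  fixes h :: "'a::real_normed_vector \<Rightarrow> 'a"
  assumes h: "Matkowski_contraction h" and s: "s > 0"
  obtains L0 where "0 \<le> L0" "L0 < 1" "\<And>L. L0 \<le> L \<Longrightarrow> L < 1 \<Longrightarrow> almost_contraction s L h"
proof -
  obtain L0 where L0: "0 \<le> L0" "L0 < 1" "\<And>x y. s \<le> dist x y \<Longrightarrow> dist (h x) (h y) \<le> L0 * dist x y"
    using Matkowski_contraction_far[OF h s] by metis
  have "almost_contraction s L h" if L: "L0 \<le> L" "L < 1" for L
    unfolding almost_contraction_def
  proof (intro allI)
    fix x y
    show "dist (h x) (h y) \<le> L * dist x y + (1 - L) * s"
    proof (cases "s \<le> dist x y")
      case True
      have "L0 * dist x y \<le> L * dist x y" using L by (intro mult_right_mono) auto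
      moreover have "0 \<le> (1 - L) * s" using L s by simp
      ultimately show ?thesis using L0(3)[OF True] by linarith
    next
      case False
      then have "(1 - L) * dist x y \<le> (1 - L) * s" using L by (intro mult_left_mono) auto
      then show ?thesis
        using Matkowski_contraction_nonexpansive[OF h, of x y] by (simp add: algebra_simps)
    qed
  qed
  then show ?thesis using L0 that by blast
qed

text \<open>The radius is the fixed point of \<open>t \<mapsto> L * t + (1 - L) + b\<close>.\<close>

lemma almost_contraction_invariant_ball:
  fixes h :: "'a::real_normed_vector \<Rightarrow> 'a"
  assumes L: "0 \<le> L" "L < 1" and h: "almost_contraction 1 L h" and b: "norm (h 0) \<le> b"
    and x: "norm x \<le> 1 + b / (1 - L)"
  shows "norm (h x) \<le> 1 + b / (1 - L)"
proof -
  have "norm (h x) \<le> dist (h x) (h 0) + norm (h 0)"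
    using norm_triangle_sub[of "h x" "h 0"] by (simp add: dist_norm)
  also have "\<dots> \<le> L * norm x + (1 - L) + b"
    using almost_contractionD[OF h, of x 0] b by simp
  also have "\<dots> \<le> L * (1 + b / (1 - L)) + (1 - L) + b"
    using x L by (intro add_right_mono mult_left_mono)
  also have "\<dots> = 1 + b / (1 - L)" using L by (simp add: field_simps)
  finally show ?thesis .
qed

section \<open>Coding of the attractor\<close>

text \<open>The first letter is applied last, so lengthening a word changes only the innermost
  argument.\<close>

primrec word_map :: "('i \<Rightarrow> 'a \<Rightarrow> 'a) \<Rightarrow> nat \<Rightarrow> (nat \<Rightarrow> 'i) \<Rightarrow> 'a \<Rightarrow> 'a" where
  "word_map h 0 \<sigma> x = x"
| "word_map h (Suc n) \<sigma> x = h (\<sigma> 0) (word_map h n (\<lambda>k. \<sigma> (Suc k)) x)"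

text \<open>The address map of the system; \<open>lim\<close> gets its meaning from
  \<open>word_map_tendsto_coded_point\<close>.\<close>

definition coded_point :: "('i \<Rightarrow> 'a \<Rightarrow> 'a) \<Rightarrow> (nat \<Rightarrow> 'i) \<Rightarrow> 'a::{t2_space,zero}" where
  "coded_point h \<sigma> = lim (\<lambda>n. word_map h n \<sigma> 0)"

lemma word_map_add:
  "word_map h (m + n) \<sigma> x = word_map h m \<sigma> (word_map h n (\<lambda>k. \<sigma> (k + m)) x)"
  by (induction m arbitrary: \<sigma>) auto

lemma word_map_cong:
  "(\<And>k. k < n \<Longrightarrow> \<sigma> k = \<tau> k) \<Longrightarrow> word_map h n \<sigma> x = word_map h n \<tau> x"
proof (induction n arbitrary: \<sigma> \<tau>)
  case (Suc n)
  have "word_map h n (\<lambda>k. \<sigma> (Suc k)) x = word_map h n (\<lambda>k. \<tau> (Suc k)) x"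
    using Suc.prems by (intro Suc.IH) simp
  then show ?case using Suc.prems[of 0] by simp
qed simp

lemma word_map_const: "word_map h n (\<lambda>_. i) x = (h i ^^ n) x"
  by (induction n) auto

lemma norm_word_map_le:
  assumes "\<And>i x. norm x \<le> R \<Longrightarrow> norm (h i x) \<le> R" "norm x \<le> R"
  shows "norm (word_map h n \<sigma> x) \<le> R"
proof (induction n arbitrary: \<sigma>)
  case (Suc n)
  show ?case using assms(1)[OF Suc.IH] by simp
qed (simp add: assms(2))

lemma dist_word_map_le:
  assumes L: "0 \<le> L" "L < 1" and s: "s > 0" and h: "\<And>i. almost_contraction s L (h i)"
  shows "dist (word_map h n \<sigma> x) (word_map h n \<sigma> y) \<le> L ^ n * dist x y + s"
proof (induction n arbitrary: \<sigma>)
  case (Suc n)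
  let ?\<sigma> = "\<lambda>k. \<sigma> (Suc k)"
  have "dist (word_map h (Suc n) \<sigma> x) (word_map h (Suc n) \<sigma> y)
      \<le> L * dist (word_map h n ?\<sigma> x) (word_map h n ?\<sigma> y) + (1 - L) * s"
    using almost_contractionD[OF h] by simp
  also have "\<dots> \<le> L * (L ^ n * dist x y + s) + (1 - L) * s"
    using L by (intro add_right_mono mult_left_mono Suc)
  finally show ?case by (simp add: algebra_simps)
qed (use s in simp)

text \<open>The factor \<open>L\<close> may depend on the scale \<open>s\<close> but serves all maps
  at once. Finiteness of the index type yields a common invariant ball and a compact code
  space.\<close>

locale contractive_ifs =
  fixes h :: "'i::finite \<Rightarrow> 'a::banach \<Rightarrow> 'a"
  assumes contractive: "s > 0 \<Longrightarrow> \<exists>L\<ge>0. L < 1 \<and> (\<forall>i. almost_contraction s L (h i))"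
begin

lemma dist_less:
  assumes "x \<noteq> y"
  shows "dist (h i x) (h i y) < dist x y"
proof -
  \<comment> \<open>At the scale of half the distance, the error \<open>(1 - L) * s\<close> makes up
    only half of the loss \<open>(1 - L) * dist x y\<close>.\<close>
  have pos: "dist x y / 2 > 0" using assms by simp
  obtain L where L: "L < 1" "almost_contraction (dist x y / 2) L (h i)" using contractive[OF pos] by blast
  have "dist (h i x) (h i y) \<le> L * dist x y + (1 - L) * (dist x y / 2)"
    using almost_contractionD[OF L(2)] .
  also have "\<dots> = dist x y - (1 - L) * (dist x y / 2)" by (simp add: field_simps)
  also have "\<dots> < dist x y" using L(1) assms by simp
  finally show ?thesis .
qed

lemma dist_le: "dist (h i x) (h i y) \<le> dist x y"
proof (cases "x = y")
  case False
  then show ?thesis by (intro less_imp_le dist_less)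
qed simp

lemma continuous: "continuous_on S (h i)"
  by (rule lipschitz_on_continuous_on[of 1]) (simp add: lipschitz_on_def dist_le)

lemma invariant_ball:
  "\<exists>R\<ge>0. \<forall>i x. norm x \<le> R \<longrightarrow> norm (h i x) \<le> R"
proof -
  obtain L where L: "0 \<le> L" "L < 1" "\<And>i. almost_contraction 1 L (h i)"
    using contractive[of 1] by auto
  define b where "b = Max (range (\<lambda>i. norm (h i 0)))"
  have b: "norm (h i 0) \<le> b" for i unfolding b_def by (rule Max_ge) auto
  have "b \<ge> 0" using b norm_ge_zero order_trans by blast
  then have "1 + b / (1 - L) \<ge> 0" using L by simp
  then show ?thesis
    using almost_contraction_invariant_ball[OF L(1,2) L(3) b] by blast
qed

text \<open>\<open>N\<close> is uniform over all codes. This gives both the convergence of the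
  coding and its continuity on the code space.\<close>

lemma word_map_tail_small:
  assumes e: "e > 0"
  obtains N where "\<And>\<sigma> x y. norm x \<le> R \<Longrightarrow> norm y \<le> R
    \<Longrightarrow> dist (word_map h N \<sigma> x) (word_map h N \<sigma> y) < e"
proof -
  have "e / 2 > 0" using e by simp
  then obtain L where L: "0 \<le> L" "L < 1" "\<And>i. almost_contraction (e / 2) L (h i)"
    using contractive by blast
  have "(\<lambda>n. L ^ n * (2 * R)) \<longlonglongrightarrow> 0 * (2 * R)"
    using L by (intro tendsto_intros LIMSEQ_realpow_zero)
  then have "\<forall>\<^sub>F n in sequentially. L ^ n * (2 * R) < e / 2"
    using e by (intro order_tendstoD(2)) auto
  then obtain N where N: "L ^ N * (2 * R) < e / 2" unfolding eventually_sequentially by blast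
  have "dist (word_map h N \<sigma> x) (word_map h N \<sigma> y) < e" if "norm x \<le> R" "norm y \<le> R" for \<sigma> x y
  proof -
    have "dist x y \<le> 2 * R" using that norm_triangle_ineq4[of x y] by (simp add: dist_norm)
    then have "L ^ N * dist x y \<le> L ^ N * (2 * R)" using L by (intro mult_left_mono) auto
    then show ?thesis
      using dist_word_map_le[of L "e / 2" h, OF L(1,2) \<open>e / 2 > 0\<close> L(3), of N \<sigma> x y] N by linarith
  qed
  then show ?thesis by (rule that)
qed

lemma word_map_tendsto_coded_point: "(\<lambda>n. word_map h n \<sigma> 0) \<longlonglongrightarrow> coded_point h \<sigma>"
proof -
  obtain R where R: "R \<ge> 0" "\<And>i x. norm x \<le> R \<Longrightarrow> norm (h i x) \<le> R"
    using invariant_ball by blast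
  have "Cauchy (\<lambda>n. word_map h n \<sigma> 0)"
  proof (rule metric_CauchyI)
    fix e :: real assume "e > 0"
    then obtain N where N: "\<And>\<sigma> x y. norm x \<le> R \<Longrightarrow> norm y \<le> R
      \<Longrightarrow> dist (word_map h N \<sigma> x) (word_map h N \<sigma> y) < e"
      using word_map_tail_small by metis
    \<comment> \<open>Both points are images of points of the invariant ball under the same prefix
      of length \<open>N\<close>.\<close>
    have "dist (word_map h m \<sigma> 0) (word_map h n \<sigma> 0) < e" if "m \<ge> N" "n \<ge> N" for m n
    proof -
      have "norm (word_map h k \<tau> 0) \<le> R" for k \<tau> using R by (intro norm_word_map_le) auto
      then show ?thesis
        using N word_map_add[of h N "m - N" \<sigma> 0] word_map_add[of h N "n - N" \<sigma> 0] that by simp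
    qed
    then show "\<exists>M. \<forall>m\<ge>M. \<forall>n\<ge>M. dist (word_map h m \<sigma> 0) (word_map h n \<sigma> 0) < e" by blast
  qed
  then show ?thesis
    unfolding coded_point_def using Cauchy_convergent convergent_LIMSEQ_iff by blast
qed

lemma norm_coded_point_le:
  assumes "R \<ge> 0" "\<And>i x. norm x \<le> R \<Longrightarrow> norm (h i x) \<le> R"
  shows "norm (coded_point h \<sigma>) \<le> R"
proof (rule LIMSEQ_le_const2)
  show "(\<lambda>n. norm (word_map h n \<sigma> 0)) \<longlonglongrightarrow> norm (coded_point h \<sigma>)"
    by (rule tendsto_norm[OF word_map_tendsto_coded_point])
  have "norm (word_map h n \<sigma> 0) \<le> R" for n using assms by (intro norm_word_map_le) auto
  then show "\<exists>N. \<forall>n\<ge>N. norm (word_map h n \<sigma> 0) \<le> R" by blast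
qed

lemma coded_point_unfold: "coded_point h \<sigma> = h (\<sigma> 0) (coded_point h (\<lambda>k. \<sigma> (Suc k)))"
proof -
  have "(\<lambda>n. h (\<sigma> 0) (word_map h n (\<lambda>k. \<sigma> (Suc k)) 0)) \<longlonglongrightarrow> h (\<sigma> 0) (coded_point h (\<lambda>k. \<sigma> (Suc k)))"
    using continuous_on_tendsto_compose[OF continuous[of UNIV "\<sigma> 0"]
        word_map_tendsto_coded_point[of "\<lambda>k. \<sigma> (Suc k)"]] by simp
  moreover have "(\<lambda>n. word_map h (Suc n) \<sigma> 0) \<longlonglongrightarrow> coded_point h \<sigma>"
    using word_map_tendsto_coded_point by (rule LIMSEQ_Suc)
  ultimately show ?thesis unfolding word_map.simps by (rule LIMSEQ_unique[rotated])
qed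

lemma coded_point_eq_word_map:
  "coded_point h \<sigma> = word_map h n \<sigma> (coded_point h (\<lambda>k. \<sigma> (k + n)))"
proof (induction n arbitrary: \<sigma>)
  case (Suc n)
  show ?case using coded_point_unfold[of \<sigma>] Suc[of "\<lambda>k. \<sigma> (Suc k)"] by simp
qed simp

lemma range_coded_point_invariant: "range (coded_point h) = (\<Union>i. h i ` range (coded_point h))"
proof (intro equalityI subsetI)
  fix x assume "x \<in> (\<Union>i. h i ` range (coded_point h))"
  then obtain i \<sigma> where "x = h i (coded_point h \<sigma>)" by blast
  then have "x = coded_point h (case_nat i \<sigma>)" using coded_point_unfold[of "case_nat i \<sigma>"] by simp
  then show "x \<in> range (coded_point h)" by simp
next
  fix x assume "x \<in> range (coded_point h)"
  then show "x \<in> (\<Union>i. h i ` range (coded_point h))" using coded_point_unfold by blast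
qed

text \<open>The code space is compact by Tychonoff, and the coding is continuous because codes with
  a long common prefix have nearby points.\<close>

lemma compact_range_coded_point: "compact (range (coded_point h))"
proof -
  define X :: "(nat \<Rightarrow> 'i) topology" where "X = product_topology (\<lambda>_. discrete_topology UNIV) UNIV"
  have top: "topspace X = UNIV" by (simp add: X_def)
  have "compactin X UNIV"
    using compact_space_product_topology[of "\<lambda>_. discrete_topology (UNIV :: 'i set)" UNIV] top
    by (simp add: X_def compact_space_def compactin_discrete_topology)
  moreover have "continuous_map X euclidean (coded_point h)"
    unfolding continuous_map_def top
  proof (intro conjI allI impI)
    fix U :: "'a set" assume "openin euclidean U"
    then have U: "open U" by simp
    obtain R where R: "R \<ge> 0" "\<And>i x. norm x \<le> R \<Longrightarrow> norm (h i x) \<le> R"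
    using invariant_ball by blast
    have "\<exists>V. openin X V \<and> \<sigma> \<in> V \<and> V \<subseteq> {\<sigma>. coded_point h \<sigma> \<in> U}" if \<sigma>: "coded_point h \<sigma> \<in> U" for \<sigma>
    proof -
      obtain e where e: "e > 0" "ball (coded_point h \<sigma>) e \<subseteq> U" using openE[OF U \<sigma>] by blast
      obtain N where N: "\<And>\<sigma> x y. norm x \<le> R \<Longrightarrow> norm y \<le> R
        \<Longrightarrow> dist (word_map h N \<sigma> x) (word_map h N \<sigma> y) < e"
        using word_map_tail_small e by metis
      \<comment> \<open>The cylinder of codes agreeing with \<open>\<sigma>\<close> in the first
        \<open>N\<close> letters.\<close>
      define V where "V = (\<Pi>\<^sub>E k\<in>UNIV. if k < N then {\<sigma> k} else UNIV)"
      have "{k. (if k < N then {\<sigma> k} else UNIV) \<noteq> topspace (discrete_topology (UNIV :: 'i set))} \<subseteq> {..<N}"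
        by auto
      then have "finite {k. (if k < N then {\<sigma> k} else UNIV) \<noteq> topspace (discrete_topology (UNIV :: 'i set))}"
        using finite_subset by blast
      then have "openin X V" unfolding X_def V_def by (intro product_topology_basis) auto
      moreover have "\<sigma> \<in> V" by (auto simp: V_def PiE_iff)
      moreover have "coded_point h \<tau> \<in> U" if "\<tau> \<in> V" for \<tau>
      proof -
        have agree: "\<tau> k = \<sigma> k" if "k < N" for k
          using \<open>\<tau> \<in> V\<close> that by (auto simp: V_def PiE_iff split: if_splits)
        have "coded_point h \<tau> = word_map h N \<sigma> (coded_point h (\<lambda>k. \<tau> (k + N)))"
          using coded_point_eq_word_map[of \<tau> N] word_map_cong[of N \<tau> \<sigma>] agree by metis
        then have "dist (coded_point h \<sigma>) (coded_point h \<tau>) < e"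
          using N norm_coded_point_le[OF R] coded_point_eq_word_map[of \<sigma> N] by metis
        then show ?thesis using e by auto
      qed
      ultimately show ?thesis by blast
    qed
    then have "openin X {\<sigma>. coded_point h \<sigma> \<in> U}"
      by (subst openin_subopen) auto
    then show "openin X {\<sigma> \<in> UNIV. coded_point h \<sigma> \<in> U}" by simp
  qed auto
  ultimately have "compactin euclidean (coded_point h ` UNIV)" by (rule image_compactin)
  then show ?thesis by simp
qed

text \<open>Let \<open>a = h i a'\<close> be a point of \<open>A\<close> farthest from
  \<open>B\<close>, and \<open>b\<close> the point of \<open>B\<close> nearest to \<open>a'\<close>.
  Then \<open>h i\<close> does not bring \<open>a'\<close> and \<open>b\<close> closer together,
  which forces \<open>a' = b\<close> and distance 0.\<close>

lemma invariant_compact_subset: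
  assumes A: "compact A" "A = (\<Union>i. h i ` A)"
    and B: "compact B" "B \<noteq> {}" "B = (\<Union>i. h i ` B)"
  shows "A \<subseteq> B"
proof (cases "A = {}")
  case False
  have "continuous_on A (\<lambda>x. infdist x B)" by (intro continuous_intros)
  then obtain a where a: "a \<in> A" "\<And>x. x \<in> A \<Longrightarrow> infdist x B \<le> infdist a B"
    using continuous_attains_sup[OF A(1) False] by metis
  obtain i a' where a': "a' \<in> A" "a = h i a'" using a(1) A(2) by blast
  have "continuous_on B (dist a')" by (intro continuous_intros)
  then obtain b where b: "b \<in> B" "\<And>y. y \<in> B \<Longrightarrow> dist a' b \<le> dist a' y"
    using continuous_attains_inf[OF B(1,2)] by blast
  have "dist a' b \<le> infdist a' B"
    unfolding infdist_notempty[OF B(2)] using B(2) b(2) by (rule cINF_greatest)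
  also have "\<dots> \<le> infdist a B" using a a' by blast
  also have "\<dots> \<le> dist a (h i b)" using b(1) B(3) by (intro infdist_le) blast
  finally have le: "dist a' b \<le> dist (h i a') (h i b)" "infdist a B \<le> dist (h i a') (h i b)"
    using \<open>infdist a B \<le> dist a (h i b)\<close> a'(2) by auto
  then have "a' = b" using dist_less[of a' b i] by force
  then have "infdist a B = 0" using le(2) infdist_nonneg[of a B] by simp
  have "x \<in> B" if "x \<in> A" for x
  proof -
    have "infdist x B = 0" using a(2)[OF that] \<open>infdist a B = 0\<close> infdist_nonneg[of x B] by simp
    then show ?thesis using in_closed_iff_infdist_zero[of B x] B compact_imp_closed by blast
  qed
  then show ?thesis by blast
qed simp

lemma attractor_eq_range_coded_point: "attractor (range h) = range (coded_point h)"
  unfolding attractor_def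
proof (rule the_equality)
  let ?A = "range (coded_point h)"
  have UN: "(\<Union>k\<in>range h. k ` A) = (\<Union>i. h i ` A)" for A by blast
  show "?A \<noteq> {} \<and> compact ?A \<and> ?A = (\<Union>k\<in>range h. k ` ?A)"
    unfolding UN by (intro conjI compact_range_coded_point range_coded_point_invariant) simp
  fix A assume "A \<noteq> {} \<and> compact A \<and> A = (\<Union>k\<in>range h. k ` A)"
  then have A: "A \<noteq> {}" "compact A" "A = (\<Union>i. h i ` A)" unfolding UN by blast+
  show "A = ?A"
  proof (rule equalityI)
    show "A \<subseteq> ?A"
      by (intro invariant_compact_subset A compact_range_coded_point range_coded_point_invariant) simp
    show "?A \<subseteq> A"
      by (intro invariant_compact_subset A compact_range_coded_point range_coded_point_invariant)
  qed
qed

end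

text \<open>Splitting off one letter bounds the supremum \<open>M\<close> of the distances by
  \<open>L * M + (1 - L) * s + \<delta>\<close>. As \<open>M\<close> is finite by boundedness of
  both codings, this can be solved for \<open>M\<close>.\<close>

lemma dist_coded_point_le:
  assumes h: "contractive_ifs h" and h': "contractive_ifs h'"
    and L: "0 \<le> L" "L < 1" "\<And>i. almost_contraction s L (h i)"
    and close: "\<And>i x. dist (h i x) (h' i x) \<le> \<delta>"
  shows "dist (coded_point h \<sigma>) (coded_point h' \<sigma>) \<le> s + \<delta> / (1 - L)"
proof -
  define D where "D \<sigma> = dist (coded_point h \<sigma>) (coded_point h' \<sigma>)" for \<sigma>
  obtain R where R: "\<And>\<sigma>. norm (coded_point h \<sigma>) \<le> R"
    using contractive_ifs.invariant_ball[OF h] contractive_ifs.norm_coded_point_le[OF h] by blast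
  obtain R' where R': "\<And>\<sigma>. norm (coded_point h' \<sigma>) \<le> R'"
    using contractive_ifs.invariant_ball[OF h'] contractive_ifs.norm_coded_point_le[OF h'] by blast
  have "D \<sigma> \<le> R + R'" for \<sigma>
    using norm_triangle_ineq4[of "coded_point h \<sigma>" "coded_point h' \<sigma>"] R[of \<sigma>] R'[of \<sigma>]
    by (simp add: D_def dist_norm)
  then have bdd: "bdd_above (range D)" by (intro bdd_aboveI[of _ "R + R'"]) auto
  have "D \<sigma> \<le> L * (SUP \<sigma>. D \<sigma>) + (1 - L) * s + \<delta>" for \<sigma>
  proof -
    let ?\<sigma> = "\<lambda>k. \<sigma> (Suc k)"
    let ?p = "coded_point h ?\<sigma>" and ?p' = "coded_point h' ?\<sigma>"
    have "D \<sigma> = dist (h (\<sigma> 0) ?p) (h' (\<sigma> 0) ?p')"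
      unfolding D_def using contractive_ifs.coded_point_unfold[OF h, of \<sigma>]
        contractive_ifs.coded_point_unfold[OF h', of \<sigma>] by simp
    also have "\<dots> \<le> dist (h (\<sigma> 0) ?p) (h (\<sigma> 0) ?p') + dist (h (\<sigma> 0) ?p') (h' (\<sigma> 0) ?p')"
      by (rule dist_triangle)
    also have "\<dots> \<le> L * D ?\<sigma> + (1 - L) * s + \<delta>"
      unfolding D_def by (intro add_mono almost_contractionD L close)
    also have "\<dots> \<le> L * (SUP \<sigma>. D \<sigma>) + (1 - L) * s + \<delta>"
      using L bdd by (intro add_right_mono mult_left_mono cSUP_upper) auto
    finally show ?thesis .
  qed
  then have "(SUP \<sigma>. D \<sigma>) \<le> L * (SUP \<sigma>. D \<sigma>) + (1 - L) * s + \<delta>" by (intro cSUP_least) auto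
  then have "(SUP \<sigma>. D \<sigma>) \<le> s + \<delta> / (1 - L)" using L by (simp add: field_simps)
  moreover have "D \<sigma> \<le> (SUP \<sigma>. D \<sigma>)" using bdd by (intro cSUP_upper) auto
  ultimately show ?thesis unfolding D_def by simp
qed

section \<open>Separation of translated iterates\<close>

lemma Lip_less_imp_lipschitz_on:
  assumes "Lip g < ereal M"
  obtains L where "L < M" "L-lipschitz_on UNIV g"
  using assms unfolding Lip_def by (auto simp: INF_less_iff)

text \<open>The infimum is attained: a pair violating the bound has a difference quotient above
  \<open>M\<close>, hence above some admissible Lipschitz constant.\<close>

lemma dist_le_of_Lip_le:
  assumes "Lip g \<le> ereal M"
  shows "dist (g x) (g y) \<le> M * dist x y"
proof (cases "x = y")
  case False
  show ?thesis
  proof (rule ccontr)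
    assume "\<not> ?thesis"
    then have "M < dist (g x) (g y) / dist x y" using False by (simp add: pos_less_divide_eq)
    then have "Lip g < ereal (dist (g x) (g y) / dist x y)" using assms by (simp add: order_le_less_trans)
    then obtain L where L: "L < dist (g x) (g y) / dist x y" "L-lipschitz_on UNIV g"
      by (rule Lip_less_imp_lipschitz_on)
    have "dist (g x) (g y) \<le> L * dist x y" using lipschitz_onD[OF L(2)] by simp
    then show False using L(1) False by (simp add: pos_less_divide_eq)
  qed
qed simp

text \<open>The translation can be recovered stably from the start and end of an orbit of length
  \<open>k\<close>, with \<open>c\<close> independent of the start.\<close>

definition separates_translations :: "nat \<Rightarrow> ('a::real_normed_vector \<Rightarrow> 'a) \<Rightarrow> bool" where
  "separates_translations k g \<longleftrightarrow> (\<exists>c>0. \<forall>x v w.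
     c * dist v w \<le> dist (((\<lambda>x. g x + v) ^^ k) x) (((\<lambda>x. g x + w) ^^ k) x))"

text \<open>The difference \<open>D k\<close> of the iterates is the partial sum of the Neumann series of the linear
  part \<open>g'\<close> at \<open>u = v - w\<close>, and \<open>D k - g' (D k) = u - g'^k u\<close>.\<close>

lemma affine_separates_translations:
  assumes g: "affine_map g" and L: "L-lipschitz_on UNIV g" "L < 1" and k: "k > 0"
  shows "separates_translations k g"
proof -
  obtain g' a where g': "linear g'" and ga: "g = (\<lambda>x. g' x + a)"
    using g unfolding affine_map_def by blast
  have L0: "L \<ge> 0" by (rule lipschitz_on_nonneg[OF L(1)])
  have contr: "norm (g' x) \<le> L * norm x" for x
    using lipschitz_onD[OF L(1), of x 0] linear_0[OF g'] by (simp add: ga dist_norm)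
  have pow: "norm ((g' ^^ n) x) \<le> L ^ n * norm x" for n x
  proof (induction n)
    case (Suc n)
    have "norm ((g' ^^ Suc n) x) \<le> L * norm ((g' ^^ n) x)" using contr by simp
    also have "\<dots> \<le> L * (L ^ n * norm x)" using L0 Suc by (intro mult_left_mono)
    finally show ?case by simp
  qed simp
  \<comment> \<open>The numerator bounds \<open>u - g'^k u\<close> from below; the 2 bounds
    \<open>D k - g' (D k)\<close> by twice the norm of \<open>D k\<close>.\<close>
  have "(1 - L ^ k) / 2 * dist v w \<le> dist (((\<lambda>x. g x + v) ^^ k) x) (((\<lambda>x. g x + w) ^^ k) x)" for x v w
  proof -
    define D where "D n = ((\<lambda>x. g x + v) ^^ n) x - ((\<lambda>x. g x + w) ^^ n) x" for n
    define u where "u = v - w"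
    have D_Suc: "D (Suc n) = g' (D n) + u" for n
      by (simp add: D_def u_def ga linear_diff[OF g'])
    have telescope: "D n - g' (D n) = u - (g' ^^ n) u" for n
    proof (induction n)
      case (Suc n)
      have "D (Suc n) - g' (D (Suc n)) = g' (D n - g' (D n)) + u - g' u"
        by (simp add: D_Suc linear_diff[OF g'] linear_add[OF g'] algebra_simps)
      then show ?case using Suc by (simp add: linear_diff[OF g'])
    qed (simp add: D_def linear_0[OF g'])
    have "norm u - L ^ k * norm u \<le> norm u - norm ((g' ^^ k) u)" using pow by simp
    also have "\<dots> \<le> norm (u - (g' ^^ k) u)" by (rule norm_triangle_ineq2)
    also have "\<dots> = norm (D k - g' (D k))" by (simp add: telescope)
    also have "\<dots> \<le> norm (D k) + norm (g' (D k))" by (rule norm_triangle_ineq4)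
    also have "\<dots> \<le> norm (D k) + 1 * norm (D k)"
      using contr[of "D k"] L(2) by (intro add_left_mono) (meson less_imp_le mult_right_mono norm_ge_zero order_trans)
    finally show ?thesis by (simp add: D_def u_def dist_norm field_simps)
  qed
  moreover have "(1 - L ^ k) / 2 > 0" using L0 L(2) k by (simp add: power_less_one_iff)
  ultimately show ?thesis unfolding separates_translations_def by blast
qed

text \<open>The distance \<open>D (n + 1)\<close> differs from \<open>dist v w\<close> by at most
  \<open>D n / 2\<close>. Inductively \<open>D n\<close> stays below \<open>2 * dist v w\<close> by
  a definite margin, and this margin leaves \<open>D (n + 1)\<close> a positive share of
  \<open>dist v w\<close>.\<close>

lemma half_lipschitz_separates_translations:
  fixes g :: "'a::real_normed_vector \<Rightarrow> 'a"
  assumes g: "\<And>x y. dist (g x) (g y) \<le> dist x y / 2" and k: "k > 0"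
  shows "separates_translations k g"
proof -
  define D where "D n x v w = dist (((\<lambda>x. g x + v) ^^ n) x) (((\<lambda>x. g x + w) ^^ n) x)" for n x v w
  have step: "\<bar>D (Suc n) x v w - dist v w\<bar> \<le> D n x v w / 2" for n x v w
  proof -
    let ?a = "((\<lambda>x. g x + v) ^^ n) x" and ?b = "((\<lambda>x. g x + w) ^^ n) x"
    have "\<bar>norm (g ?a + v - (g ?b + w)) - norm (v - w)\<bar> \<le> norm (g ?a + v - (g ?b + w) - (v - w))"
      by (rule norm_triangle_ineq3)
    also have "\<dots> = dist (g ?a) (g ?b)" by (simp add: dist_norm algebra_simps)
    also have "\<dots> \<le> dist ?a ?b / 2" by (rule g)
    finally show ?thesis by (simp add: D_def dist_norm)
  qed
  have upper: "D n x v w \<le> 2 * dist v w - 2 * ((1 / 2) ^ n * dist v w)" for n x v w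
  proof (induction n)
    case (Suc n)
    then show ?case
      using abs_le_D1[OF step[of n x v w]] unfolding power_Suc mult.assoc by linarith
  qed (simp add: D_def)
  obtain n where n: "k = Suc n" using k gr0_implies_Suc by blast
  have "(1 / 2) ^ n * dist v w \<le> D k x v w" for x v w
    using abs_le_D2[OF step[of n x v w]] upper[of n x v w] unfolding n by linarith
  moreover have "(1 / 2 :: real) ^ n > 0" by simp
  ultimately show ?thesis unfolding separates_translations_def D_def by blast
qed

lemma dist_iterate_translate_le:
  fixes g :: "'a::real_normed_vector \<Rightarrow> 'a"
  assumes "\<And>x y. dist (g x) (g y) \<le> dist x y"
  shows "dist (((\<lambda>x. g x + v) ^^ k) x) (((\<lambda>x. g x + w) ^^ k) y) \<le> dist x y + real k * dist v w"
proof (induction k)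
  case (Suc k)
  let ?a = "((\<lambda>x. g x + v) ^^ k) x" and ?b = "((\<lambda>x. g x + w) ^^ k) y"
  have "dist (g ?a + v) (g ?b + w) \<le> dist (g ?a) (g ?b) + dist v w" by (rule dist_triangle_add)
  also have "\<dots> \<le> dist ?a ?b + dist v w" using assms by simp
  finally show ?case using Suc by (simp add: algebra_simps)
qed simp

text \<open>Along a subsequence the starts and ends converge in \<open>K\<close>. Separation then
  makes the parameters Cauchy, and the limit belongs to the set because iterates depend continuously
  on start and parameter.\<close>

lemma compact_iterate_translations:
  fixes g :: "'a::banach \<Rightarrow> 'a"
  assumes g: "\<And>x y. dist (g x) (g y) \<le> dist x y" and sep: "separates_translations k g"
    and K: "compact K"
  shows "compact {w. \<exists>x\<in>K. ((\<lambda>x. g x + w) ^^ k) x \<in> K}" (is "compact ?S")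
  unfolding compact_def
proof (intro allI impI)
  fix w :: "nat \<Rightarrow> 'a" assume "\<forall>n. w n \<in> ?S"
  then have "\<forall>n. \<exists>x. x \<in> K \<and> ((\<lambda>x. g x + w n) ^^ k) x \<in> K" by blast
  then obtain x where x: "\<And>n. x n \<in> K" "\<And>n. ((\<lambda>x. g x + w n) ^^ k) (x n) \<in> K" by metis
  define y where "y n = ((\<lambda>x. g x + w n) ^^ k) (x n)" for n
  obtain c where c: "c > 0" "\<And>x v w. c * dist v w
      \<le> dist (((\<lambda>x. g x + v) ^^ k) x) (((\<lambda>x. g x + w) ^^ k) x)"
    using sep unfolding separates_translations_def by blast
  have "compact (K \<times> K)" using K by (intro compact_Times)
  moreover have "\<forall>n. (x n, y n) \<in> K \<times> K" using x by (simp add: y_def)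
  ultimately obtain p r where p: "p \<in> K \<times> K" and r: "strict_mono (r :: nat \<Rightarrow> nat)"
    and lim: "((\<lambda>n. (x n, y n)) \<circ> r) \<longlonglongrightarrow> p"
    unfolding compact_def by (metis (no_types, lifting))
  have limx: "(x \<circ> r) \<longlonglongrightarrow> fst p" and limy: "(y \<circ> r) \<longlonglongrightarrow> snd p"
    using tendsto_fst[OF lim] tendsto_snd[OF lim] by (simp_all add: o_def)
  have "Cauchy (w \<circ> r)"
  proof (rule metric_CauchyI)
    fix e :: real assume "e > 0"
    then have e: "c * e / 2 > 0" using c by simp
    obtain M where M: "\<And>m n. m \<ge> M \<Longrightarrow> n \<ge> M \<Longrightarrow> dist ((x \<circ> r) m) ((x \<circ> r) n) < c * e / 2"
      using LIMSEQ_imp_Cauchy[OF limx] e unfolding Cauchy_def by metis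
    obtain M' where M': "\<And>m n. m \<ge> M' \<Longrightarrow> n \<ge> M' \<Longrightarrow> dist ((y \<circ> r) m) ((y \<circ> r) n) < c * e / 2"
      using LIMSEQ_imp_Cauchy[OF limy] e unfolding Cauchy_def by metis
    have "dist ((w \<circ> r) m) ((w \<circ> r) n) < e" if mn: "m \<ge> max M M'" "n \<ge> max M M'" for m n
    proof -
      \<comment> \<open>The mixed orbit differs from the orbit of index \<open>r m\<close> only in
        the parameter and from that of index \<open>r n\<close> only in the start.\<close>
      let ?z = "((\<lambda>x. g x + w (r n)) ^^ k) (x (r m))"
      have "c * dist (w (r m)) (w (r n)) \<le> dist (y (r m)) ?z" unfolding y_def by (rule c(2))
      also have "\<dots> \<le> dist (y (r m)) (y (r n)) + dist (y (r n)) ?z" by (rule dist_triangle)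
      also have "dist (y (r n)) ?z \<le> dist (x (r m)) (x (r n))"
        using dist_iterate_translate_le[OF g, of k "w (r n)" "x (r n)" "w (r n)" "x (r m)"]
        by (simp add: y_def dist_commute)
      also have "dist (y (r m)) (y (r n)) + dist (x (r m)) (x (r n)) < c * e / 2 + c * e / 2"
        using M[of m n] M'[of m n] mn by (intro add_strict_mono) auto
      finally show ?thesis using c(1) by simp
    qed
    then show "\<exists>M. \<forall>m\<ge>M. \<forall>n\<ge>M. dist ((w \<circ> r) m) ((w \<circ> r) n) < e" by blast
  qed
  then obtain l where l: "(w \<circ> r) \<longlonglongrightarrow> l" using Cauchy_convergent convergent_def by blast
  have "(\<lambda>n. dist ((x \<circ> r) n) (fst p) + real k * dist ((w \<circ> r) n) l) \<longlonglongrightarrow> 0 + real k * 0"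
    by (intro tendsto_add tendsto_mult tendsto_const iffD1[OF tendsto_dist_iff] limx l)
  then have lim0: "(\<lambda>n. dist ((x \<circ> r) n) (fst p) + real k * dist ((w \<circ> r) n) l) \<longlonglongrightarrow> 0" by simp
  have "dist ((y \<circ> r) n) (((\<lambda>x. g x + l) ^^ k) (fst p))
      \<le> dist ((x \<circ> r) n) (fst p) + real k * dist ((w \<circ> r) n) l" for n
    unfolding y_def o_apply by (rule dist_iterate_translate_le[OF g])
  then have "(\<lambda>n. dist ((y \<circ> r) n) (((\<lambda>x. g x + l) ^^ k) (fst p))) \<longlonglongrightarrow> 0"
    by (intro tendsto_sandwich[OF always_eventually always_eventually tendsto_const lim0])
      (rule allI, simp only: zero_le_dist)+
  then have "(y \<circ> r) \<longlonglongrightarrow> ((\<lambda>x. g x + l) ^^ k) (fst p)" by (rule iffD2[OF tendsto_dist_iff])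
  then have "((\<lambda>x. g x + l) ^^ k) (fst p) = snd p" using limy LIMSEQ_unique by blast
  then have "l \<in> ?S" using p by auto
  then show "\<exists>l\<in>?S. \<exists>r. strict_mono r \<and> (w \<circ> r) \<longlonglongrightarrow> l" using l r by blast
qed

section \<open>The connectedness set\<close>

text \<open>A disconnected compact set splits into two closed parts at a positive distance
  \<open>d\<close>. Their \<open>d / 2\<close>-neighbourhoods are disjoint and still separate every
  set that is Hausdorff-close.\<close>

lemma not_connected_nearby:
  fixes A :: "'a::metric_space set"
  assumes "compact A" "\<not> connected A"
  obtains e where "e > 0"
    "\<And>B. \<lbrakk>\<And>x. x \<in> A \<Longrightarrow> \<exists>y\<in>B. dist x y < e; \<And>y. y \<in> B \<Longrightarrow> \<exists>x\<in>A. dist x y < e\<rbrakk> \<Longrightarrow> \<not> connected B"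
proof -
  obtain S T where ST: "closed S" "closed T" "S \<noteq> {}" "T \<noteq> {}" "S \<union> T = A" "S \<inter> T = {}"
    using assms connected_closed_set compact_imp_closed by metis
  have S: "compact S" using ST(1,5) assms(1) by (metis Int_absorb1 Un_upper1 compact_Int_closed)
  obtain d where d: "d > 0" "\<And>x y. x \<in> S \<Longrightarrow> y \<in> T \<Longrightarrow> d \<le> dist x y"
  proof -
    have "open (- T)" "S \<subseteq> - T" using ST by auto
    then obtain d where "d > 0" "(\<Union>x\<in>S. ball x d) \<subseteq> - T"
      using compact_subset_open_imp_ball_epsilon_subset[OF S] by metis
    then show ?thesis by (intro that[of d]) (force simp: subset_iff not_less)+
  qed
  show ?thesis
  proof (rule that[of "d / 2"])
    fix B
    assume 1: "\<And>x. x \<in> A \<Longrightarrow> \<exists>y\<in>B. dist x y < d / 2"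
      and 2: "\<And>y. y \<in> B \<Longrightarrow> \<exists>x\<in>A. dist x y < d / 2"
    define U where "U = (\<Union>x\<in>S. ball x (d / 2))"
    define V where "V = (\<Union>x\<in>T. ball x (d / 2))"
    have "open U" "open V" unfolding U_def V_def by auto
    moreover have "U \<inter> V = {}"
    proof -
      have False if "x \<in> S" "y \<in> T" "dist x z < d / 2" "dist y z < d / 2" for x y z
        using d(2)[OF that(1,2)] that(3,4) dist_triangle2[of x y z] by simp
      then show ?thesis unfolding U_def V_def by auto
    qed
    moreover have "B \<subseteq> U \<union> V"
    proof
      fix y assume "y \<in> B"
      then obtain x where "x \<in> S \<union> T" "dist x y < d / 2" using 2 ST(5) by blast
      then show "y \<in> U \<union> V" unfolding U_def V_def by auto
    qed
    moreover have "U \<inter> B \<noteq> {}" "V \<inter> B \<noteq> {}"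
    proof -
      obtain a b where "a \<in> S" "b \<in> T" using ST(3,4) by blast
      then obtain a' b' where "a' \<in> B" "dist a a' < d / 2" "b' \<in> B" "dist b b' < d / 2"
        using 1 ST(5) by blast
      then have "a' \<in> U \<inter> B" "b' \<in> V \<inter> B"
        using \<open>a \<in> S\<close> \<open>b \<in> T\<close> unfolding U_def V_def by auto
      then show "U \<inter> B \<noteq> {}" "V \<inter> B \<noteq> {}" by blast+
    qed
    ultimately show "\<not> connected B" unfolding connected_def by blast
  qed (use d in simp)
qed

text \<open>Indexing by \<open>bool\<close> gives all parameters \<open>w\<close> the same code
  space, so equally coded points can be compared.\<close>

definition pair_ifs :: "('a \<Rightarrow> 'a) \<Rightarrow> ('a \<Rightarrow> 'a) \<Rightarrow> 'a \<Rightarrow> bool \<Rightarrow> 'a::plus \<Rightarrow> 'a" where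
  "pair_ifs f g w i = (if i then f else (\<lambda>x. g x + w))"

lemma range_pair_ifs: "range (pair_ifs f g w) = {f, \<lambda>x. g x + w}"
  by (auto simp: pair_ifs_def UNIV_bool)

context
  fixes f g :: "'a::banach \<Rightarrow> 'a"
  assumes f: "Matkowski_contraction f" and g: "Matkowski_contraction g"
begin

text \<open>Translations do not affect the estimate, so one \<open>L\<close> serves all
  \<open>w\<close>.\<close>

lemma almost_contraction_pair_ifs:
  assumes s: "s > 0"
  obtains L where "0 \<le> L" "L < 1" "\<And>w i. almost_contraction s L (pair_ifs f g w i)"
proof -
  obtain L1 where L1: "0 \<le> L1" "L1 < 1" "\<And>L. L1 \<le> L \<Longrightarrow> L < 1 \<Longrightarrow> almost_contraction s L f"
    using Matkowski_contraction_imp_almost_contraction[OF f s] by blast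
  obtain L2 where L2: "0 \<le> L2" "L2 < 1" "\<And>L. L2 \<le> L \<Longrightarrow> L < 1 \<Longrightarrow> almost_contraction s L g"
    using Matkowski_contraction_imp_almost_contraction[OF g s] by blast
  show ?thesis
  proof (rule that[of "max L1 L2"])
    show "almost_contraction s (max L1 L2) (pair_ifs f g w i)" for w i
      using L1(2) L2(2) L1(3)[of "max L1 L2"] L2(3)[of "max L1 L2"]
      by (simp add: pair_ifs_def almost_contraction_translate)
  qed (use L1 L2 in auto)
qed

lemma contractive_pair_ifs: "contractive_ifs (pair_ifs f g w)"
proof
  fix s :: real assume "s > 0"
  then show "\<exists>L\<ge>0. L < 1 \<and> (\<forall>i. almost_contraction s L (pair_ifs f g w i))"
    using almost_contraction_pair_ifs by metis
qed

lemma connectedness_set_iff: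
  "w \<in> connectedness_set f g \<longleftrightarrow> connected (range (coded_point (pair_ifs f g w)))"
  using contractive_ifs.attractor_eq_range_coded_point[OF contractive_pair_ifs]
  by (simp add: connectedness_set_def range_pair_ifs)

lemma closed_connectedness_set: "closed (connectedness_set f g)"
proof -
  have "\<exists>d>0. \<forall>w'. dist w' w < d \<longrightarrow> w' \<in> - connectedness_set f g"
    if w: "w \<in> - connectedness_set f g" for w
  proof -
    let ?p = "\<lambda>w. coded_point (pair_ifs f g w)"
    have "\<not> connected (range (?p w))" using w by (simp add: connectedness_set_iff)
    then obtain e where e: "e > 0" and near: "\<And>B. (\<And>x. x \<in> range (?p w) \<Longrightarrow> \<exists>y\<in>B. dist x y < e)
        \<Longrightarrow> (\<And>y. y \<in> B \<Longrightarrow> \<exists>x\<in>range (?p w). dist x y < e) \<Longrightarrow> \<not> connected B"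
      using not_connected_nearby[OF contractive_ifs.compact_range_coded_point[OF contractive_pair_ifs]]
      by blast
    obtain L where L: "0 \<le> L" "L < 1" "\<And>w i. almost_contraction (e / 2) L (pair_ifs f g w i)"
      using almost_contraction_pair_ifs[of "e / 2"] e by auto
    \<comment> \<open>With this radius the perturbation contributes less than \<open>e / 2\<close>
      to the distance of equally coded points; the other half is the additive error.\<close>
    have "w' \<in> - connectedness_set f g" if w': "dist w' w < (1 - L) * (e / 2)" for w'
    proof -
      have "dist (?p w \<sigma>) (?p w' \<sigma>) < e" for \<sigma>
      proof -
        have "dist (?p w \<sigma>) (?p w' \<sigma>) \<le> e / 2 + dist w' w / (1 - L)"
          by (rule dist_coded_point_le[OF contractive_pair_ifs contractive_pair_ifs L])
            (simp add: pair_ifs_def dist_commute)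
        also have "\<dots> < e / 2 + e / 2"
          using w' L by (intro add_strict_left_mono) (simp add: pos_divide_less_eq mult.commute)
        finally show ?thesis by simp
      qed
      then have "\<not> connected (range (?p w'))" by (intro near) blast+
      then show ?thesis by (simp add: connectedness_set_iff)
    qed
    moreover have "(1 - L) * (e / 2) > 0" using L e by simp
    ultimately show ?thesis by blast
  qed
  then show ?thesis unfolding closed_def open_dist by blast
qed

lemma bounded_coded_points:
  obtains R where "\<And>w \<sigma>. norm w \<le> r \<Longrightarrow> norm (coded_point (pair_ifs f g w) \<sigma>) \<le> R"
proof -
  obtain L where L: "0 \<le> L" "L < 1" "\<And>w i. almost_contraction 1 L (pair_ifs f g w i)"
    using almost_contraction_pair_ifs[of 1] by auto
  \<comment> \<open>A bound at 0 for both maps and all admissible \<open>w\<close>, so the invariant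
    ball is independent of \<open>w\<close>.\<close>
  define b where "b = norm (f 0) + norm (g 0) + r"
  have "norm (coded_point (pair_ifs f g w) \<sigma>) \<le> 1 + b / (1 - L)" if w: "norm w \<le> r" for w \<sigma>
  proof (rule contractive_ifs.norm_coded_point_le[OF contractive_pair_ifs])
    have "0 \<le> r" using w norm_ge_zero order_trans by blast
    then have "0 \<le> b" by (simp add: b_def)
    then show "0 \<le> 1 + b / (1 - L)" using L by simp
    fix i and x :: 'a assume "norm x \<le> 1 + b / (1 - L)"
    moreover have "norm (g 0 + w) \<le> b" "norm (f 0) \<le> b"
      using norm_triangle_ineq[of "g 0" w] w \<open>0 \<le> r\<close> norm_ge_zero[of "f 0"] norm_ge_zero[of "g 0"]
      unfolding b_def by linarith+
    then have "norm (pair_ifs f g w i 0) \<le> b" by (simp add: pair_ifs_def)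
    ultimately show "norm (pair_ifs f g w i x) \<le> 1 + b / (1 - L)"
      using almost_contraction_invariant_ball[OF L(1,2) L(3)] by blast
  qed
  then show ?thesis by (rule that)
qed

text \<open>The images of a connected attractor under both maps meet. Reading off the code of a common
  point \<open>y\<close>, either \<open>f\<close> occurs in it, or \<open>y\<close> is the fixed point of \<open>\<lambda>x. g x + w\<close>.\<close>

lemma connectedness_set_cases:
  assumes w: "w \<in> connectedness_set f g"
  defines "A \<equiv> range (coded_point (pair_ifs f g w))"
  obtains k a a' where "a \<in> A" "a' \<in> A" "((\<lambda>x. g x + w) ^^ Suc k) (f a') = f a"
  | a where "a \<in> A" "w = f a - g (f a)"
proof -
  interpret contractive_ifs "pair_ifs f g w" by (rule contractive_pair_ifs)
  let ?p = "coded_point (pair_ifs f g w)" and ?g = "\<lambda>x. g x + w"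
  have maps: "pair_ifs f g w True = f" "pair_ifs f g w False = ?g" by (simp_all add: pair_ifs_def)
  have compact: "compact (pair_ifs f g w i ` A)" for i
    unfolding A_def by (intro compact_continuous_image continuous compact_range_coded_point)
  have "A = pair_ifs f g w True ` A \<union> pair_ifs f g w False ` A"
    using range_coded_point_invariant unfolding A_def[symmetric] by (simp add: UNIV_bool Un_commute)
  moreover have "connected A" using w by (simp add: A_def connectedness_set_iff)
  ultimately have "pair_ifs f g w True ` A \<inter> pair_ifs f g w False ` A \<noteq> {}"
    using compact compact_imp_closed by (intro connected_as_closed_union[of A]) (auto simp: A_def)
  then obtain a b where a: "a \<in> A" and b: "b \<in> A" and ab: "f a = ?g b" unfolding maps by auto
  obtain \<sigma> where "b = ?p \<sigma>" using b unfolding A_def by auto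
  \<comment> \<open>The code of \<open>f a\<close> begins with \<open>False\<close>, so the first
    \<open>True\<close> comes at a positive position and the exponent is a successor.\<close>
  define \<tau> where "\<tau> = case_nat False \<sigma>"
  have y: "f a = ?p \<tau>"
    using coded_point_unfold[of \<tau>] ab \<open>b = ?p \<sigma>\<close> by (simp add: \<tau>_def maps)
  show thesis
  proof (cases "\<exists>k. \<tau> k")
    case True
    define n where "n = (LEAST k. \<tau> k)"
    have n: "\<tau> n" "\<And>k. k < n \<Longrightarrow> \<not> \<tau> k"
      unfolding n_def by (rule LeastI_ex[OF True]) (rule not_less_Least)
    have "\<not> \<tau> 0" by (simp add: \<tau>_def)
    then have "n \<noteq> 0" using n(1) by metis
    then obtain k where k: "n = Suc k" using not0_implies_Suc by blast
    let ?a' = "?p (\<lambda>k. \<tau> (Suc k + n))"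
    have "?p (\<lambda>k. \<tau> (k + n)) = f ?a'"
      using coded_point_unfold[of "\<lambda>k. \<tau> (k + n)"] n(1) by (simp add: maps)
    then have "f a = word_map (pair_ifs f g w) n \<tau> (f ?a')"
      using y coded_point_eq_word_map[of \<tau> n] by simp
    also have "\<dots> = word_map (pair_ifs f g w) n (\<lambda>_. False) (f ?a')"
      using n(2) by (intro word_map_cong) simp
    also have "\<dots> = (?g ^^ Suc k) (f ?a')" by (simp only: word_map_const maps k)
    finally show thesis using that(1)[of a ?a' k] a unfolding A_def by simp
  next
    case False
    \<comment> \<open>The shift of this code is the code itself, so \<open>f a\<close> is fixed by
      \<open>?g\<close>.\<close>
    then have "\<tau> = (\<lambda>_. False)" by auto
    then have "f a = g (f a) + w" using y coded_point_unfold[of \<tau>] by (simp add: maps)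
    then have "w = f a - g (f a)" by (metis add_diff_cancel_left')
    then show thesis using that(2) a by blast
  qed
qed

lemma connectedness_set_sigma_compact:
  assumes cf: "compact_map f" and sep: "\<And>k. separates_translations (Suc k) g"
  shows "(countable union_of compact) (connectedness_set f g)"
proof -
  let ?C = "connectedness_set f g"
  have "\<exists>R. \<forall>w \<sigma>. norm w \<le> real n \<longrightarrow> norm (coded_point (pair_ifs f g w) \<sigma>) \<le> R" for n
    using bounded_coded_points[of "real n"] by metis
  then obtain R where R: "\<And>n w \<sigma>. norm w \<le> real n \<Longrightarrow> norm (coded_point (pair_ifs f g w) \<sigma>) \<le> R n"
    by metis
  \<comment> \<open>By compactness of \<open>f\<close>, one compact set contains the
    \<open>f\<close>-images of the attractors of all \<open>w\<close> with norm at most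
    \<open>n\<close>.\<close>
  define K where "K n = closure (f ` cball 0 (R n))" for n :: nat
  have K: "compact (K n)" for n
    using cf unfolding compact_map_def K_def by simp
  note g_le = Matkowski_contraction_nonexpansive[OF g]
  define S where "S n k = {w. \<exists>x\<in>K n. ((\<lambda>x. g x + w) ^^ Suc k) x \<in> K n}" for n k
  define T where "T n = (\<lambda>y. y - g y) ` K n" for n
  \<comment> \<open>\<open>S n k\<close> and \<open>T n\<close> may contain parameters with
    disconnected attractor; intersecting with the closed set \<open>?C\<close> removes these and
    preserves compactness.\<close>
  define U where "U = (\<lambda>(n, k). ?C \<inter> (S n k \<union> T n))"
  have "continuous_on X g" for X
    by (rule lipschitz_on_continuous_on[of 1]) (simp add: lipschitz_on_def g_le)
  then have "compact (T n)" for n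
    unfolding T_def by (intro compact_continuous_image continuous_intros K)
  moreover have "compact (S n k)" for n k
    unfolding S_def by (intro compact_iterate_translations g_le sep K)
  ultimately have "compact (U p)" for p
    unfolding U_def by (cases p) (auto intro!: closed_Int_compact closed_connectedness_set compact_Un)
  moreover have "\<Union> (range U) = ?C"
  proof
    show "?C \<subseteq> \<Union> (range U)"
    proof
      fix w assume w: "w \<in> ?C"
      obtain n where n: "norm w \<le> real n" using real_arch_simple by blast
      have fK: "f a \<in> K n" if "a \<in> range (coded_point (pair_ifs f g w))" for a
        unfolding K_def using R[OF n] that by (intro closure_subset[THEN subsetD] imageI) auto
      have "\<exists>k. w \<in> S n k \<union> T n"
      proof (rule connectedness_set_cases[OF w])
        fix k a a' assume "a \<in> range (coded_point (pair_ifs f g w))" "a' \<in> range (coded_point (pair_ifs f g w))"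
          "((\<lambda>x. g x + w) ^^ Suc k) (f a') = f a"
        then have "w \<in> S n k"
          unfolding S_def using fK[of a] fK[of a'] by (intro CollectI bexI[of _ "f a'"]) simp_all
        then show ?thesis by blast
      next
        fix a assume "a \<in> range (coded_point (pair_ifs f g w))" "w = f a - g (f a)"
        then show ?thesis unfolding T_def using fK by blast
      qed
      then show "w \<in> \<Union> (range U)" using w unfolding U_def by auto
    qed
  qed (auto simp: U_def)
  ultimately show ?thesis
    unfolding union_of_def by (intro exI[of _ "range U"]) auto
qed

end

theorem theorem2p3:
  fixes f g :: "'a::banach \<Rightarrow> 'a"
  assumes "Matkowski_contraction f"
    and "Matkowski_contraction g"
    and "compact_map f"
    and "(affine_map g \<and> Lip g < 1) \<or> Lip g \<le> ereal (1/2)"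
  shows "(countable union_of compact) (connectedness_set f g) \<and>
         (infinite_dimensional TYPE('a) \<longrightarrow> sigma_c_porous (connectedness_set f g))"
proof -
  have "separates_translations (Suc k) g" for k
    using assms(4)
  proof
    assume g: "affine_map g \<and> Lip g < 1"
    then have "Lip g < ereal 1" by (simp add: one_ereal_def)
    then obtain L where "L < 1" "L-lipschitz_on UNIV g" by (rule Lip_less_imp_lipschitz_on)
    then show ?thesis using g by (intro affine_separates_translations) auto
  next
    assume "Lip g \<le> ereal (1/2)"
    from dist_le_of_Lip_le[OF this] show ?thesis
      by (intro half_lipschitz_separates_translations) auto
  qed
  then have compact: "(countable union_of compact) (connectedness_set f g)"
    by (intro connectedness_set_sigma_compact assms)
  moreover have "sigma_c_porous (connectedness_set f g)" if "infinite_dimensional TYPE('a)"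
    unfolding sigma_c_porous_def using compact compact_imp_c_porous[OF _ that]
    by (rule union_of_mono)
  ultimately show ?thesis by blast
qed

end
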